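(* Let $\varphi$ be a track function, let $\delta:[0,1]\to[0,1]$ be increasing with $\delta(1)=1$ and $\delta(t)\le\min\{t,\varphi(t)\}$ for all $t\in[0,1]$, and let $\psi:[0,1]\to\mathbb{R}$ satisfy $\psi(0)=0$. Then the following are equivalent: (a) The canonical functions $\psi,\chi,\eta,\xi$ are all increasing on $[0,1]$. (b) For all $0\le x\le y\le1$, $$V^-_{x,y}(\varphi-\delta)\le\psi(y)-\psi(x)\le(y-x)-V^+_{x,y}(\zeta),$$ where $\zeta(x)=x-\delta(x)$. (c) $C_\psi$ is a copula satisfying $C_\psi(x,\varphi(x))=\delta(x)$ for all $x\in[0,1]$.
   Context: "Increasing" means non-decreasing; $a\wedge b=\min\{a,b\}$. A track function is a strictly increasing continuous $\varphi:[0,1]\to[0,1]$ with $\varphi(0)=0$, $\varphi(1)=1$. Given $\varphi,\delta,\psi$, the canonical functions are $\psi$ itself and $$\eta(y)=\delta(\varphi^{-1}(y))-\psi(\varphi^{-1}(y)),\quad \chi(y)=y-\eta(y),\quad \xi(x)=x-\psi(x),$$ and $C_\psi(x,y)=(\psi(x)\wedge\chi(y))+(\xi(x)\wedge\eta(y))$ for $(x,y)\in[0,1]^2$. For a real function $g$ on $[0,1]$ and $x\le y$, the positive and negative variations are $V^+_{x,y}(g)=\sup\sum_{i=1}^n\max\{g(x_i)-g(x_{i-1}),0\}$ and $V^-_{x,y}(g)=\sup\sum_{i=1}^n\max\{g(x_{i-1})-g(x_i),0\}$, suprema over all partitions $x=x_0<x_1<\dots<x_n=y$ (and both are $0$ if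 $x=y$). A bivariate copula is a function $C:[0,1]^2\to[0,1]$ with $C(x,0)=C(0,x)=0$, $C(x,1)=C(1,x)=x$ and $C(x_2,y_2)-C(x_1,y_2)-C(x_2,y_1)+C(x_1,y_1)\ge0$ whenever $x_1\le x_2$, $y_1\le y_2$. *)

theory Defs
  imports "HOL-Analysis.Analysis"
begin

text \<open>Functions on the unit interval are represented by total functions on the reals, of which
  only the values on \<open>{0..1}\<close> are ever used.\<close>

definition track_function :: "(real \<Rightarrow> real) \<Rightarrow> bool" where
  "track_function \<phi> \<longleftrightarrow>
     \<phi> \<in> {0..1} \<rightarrow> {0..1} \<and> strict_mono_on {0..1} \<phi> \<and> continuous_on {0..1} \<phi> \<and>
     \<phi> 0 = 0 \<and> \<phi> 1 = 1"

definition can_eta :: "(real \<Rightarrow> real) \<Rightarrow> (real \<Rightarrow> real) \<Rightarrow> (real \<Rightarrow> real) \<Rightarrow> real \<Rightarrow> real" where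
  "can_eta \<phi> \<delta> \<psi> y = \<delta> (inv_into {0..1} \<phi> y) - \<psi> (inv_into {0..1} \<phi> y)"

definition can_chi :: "(real \<Rightarrow> real) \<Rightarrow> (real \<Rightarrow> real) \<Rightarrow> (real \<Rightarrow> real) \<Rightarrow> real \<Rightarrow> real" where
  "can_chi \<phi> \<delta> \<psi> y = y - can_eta \<phi> \<delta> \<psi> y"

definition can_xi :: "(real \<Rightarrow> real) \<Rightarrow> real \<Rightarrow> real" where
  "can_xi \<psi> x = x - \<psi> x"

definition can_C ::
  "(real \<Rightarrow> real) \<Rightarrow> (real \<Rightarrow> real) \<Rightarrow> (real \<Rightarrow> real) \<Rightarrow> real \<Rightarrow> real \<Rightarrow> real" where
  "can_C \<phi> \<delta> \<psi> x y =
     min (\<psi> x) (can_chi \<phi> \<delta> \<psi> y) + min (can_xi \<psi> x) (can_eta \<phi> \<delta> \<psi> y)"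

definition is_partition :: "real \<Rightarrow> real \<Rightarrow> nat \<Rightarrow> (nat \<Rightarrow> real) \<Rightarrow> bool" where
  "is_partition x y n p \<longleftrightarrow> p 0 = x \<and> p n = y \<and> (\<forall>i<n. p i < p (Suc i))"

text \<open>The variations are extended reals, so that they are the genuine suprema also for functions
  of unbounded variation. They are meant for \<open>x \<le> y\<close>.\<close>

definition pos_variation :: "(real \<Rightarrow> real) \<Rightarrow> real \<Rightarrow> real \<Rightarrow> ereal" where
  "pos_variation g x y =
     (if x = y then 0
      else Sup {ereal (\<Sum>i=1..n. max (g (p i) - g (p (i - 1))) 0) |n p. is_partition x y n p})"

definition neg_variation :: "(real \<Rightarrow> real) \<Rightarrow> real \<Rightarrow> real \<Rightarrow> ereal" where
  "neg_variation g x y =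
     (if x = y then 0
      else Sup {ereal (\<Sum>i=1..n. max (g (p (i - 1)) - g (p i)) 0) |n p. is_partition x y n p})"

definition copula :: "(real \<Rightarrow> real \<Rightarrow> real) \<Rightarrow> bool" where
  "copula C \<longleftrightarrow>
     (\<forall>x\<in>{0..1}. \<forall>y\<in>{0..1}. C x y \<in> {0..1}) \<and>
     (\<forall>x\<in>{0..1}. C x 0 = 0 \<and> C 0 x = 0 \<and> C x 1 = x \<and> C 1 x = x) \<and>
     (\<forall>x1\<in>{0..1}. \<forall>x2\<in>{0..1}. \<forall>y1\<in>{0..1}. \<forall>y2\<in>{0..1}.
        x1 \<le> x2 \<longrightarrow> y1 \<le> y2 \<longrightarrow> C x2 y2 - C x1 y2 - C x2 y1 + C x1 y1 \<ge> 0)"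

end

theory Submission
  imports Defs
begin

text \<open>Write increments over \<open>s \<le> t\<close>. Condition (a) says
  \<open>max 0 (\<Delta>\<delta> - \<Delta>\<phi>) \<le> \<Delta>\<psi> \<le> \<Delta>t - max 0 (\<Delta>t - \<Delta>\<delta>)\<close>; summing over partitions gives (b), and the
  one-interval partition gives the converse. For (c), the minimum of an increasing function of \<open>x\<close>
  and an increasing function of \<open>y\<close> is 2-increasing. Conversely
  \<open>C x y \<le> \<psi> x + \<eta> y\<close> with equality on the graph of \<open>\<phi>\<close>, so moving one coordinate away from
  a graph point, monotonicity and the Lipschitz property of a copula bound the increments of
  \<open>\<psi>\<close> and \<open>\<eta>\<close> by \<open>0\<close> from below and by those of the identity from above.\<close>

lemma neg_variation_eq_pos_variation: "neg_variation g x y = pos_variation (\<lambda>t. - g t) x y"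
  by (simp add: neg_variation_def pos_variation_def add.commute)

text \<open>The bounds on single intervals telescope. The endpoint \<open>y\<close> varies in the
  induction while \<open>b\<close> stays fixed, so the increment hypothesis carries over unchanged;
  \<open>x \<le> y\<close> is proved along with the sum because the step needs
  \<open>x \<le> p n\<close> to apply that hypothesis on the last interval.\<close>

lemma partition_sum_le:
  fixes g G :: "real \<Rightarrow> real"
  assumes "is_partition x y n p" and "y \<le> b"
    and "\<And>s t. x \<le> s \<Longrightarrow> s \<le> t \<Longrightarrow> t \<le> b \<Longrightarrow> max (g t - g s) 0 \<le> G t - G s"
  shows "x \<le> y \<and> (\<Sum>i=1..n. max (g (p i) - g (p (i - 1))) 0) \<le> G y - G x"
  using assms(1,2)
proof (induction n arbitrary: y)
  case 0
  then show ?case by (auto simp: is_partition_def)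
next
  case (Suc n)
  then have *: "is_partition x (p n) n p" "p n < y" "p (Suc n) = y"
    by (auto simp: is_partition_def)
  with Suc have IH: "x \<le> p n" "(\<Sum>i=1..n. max (g (p i) - g (p (i - 1))) 0) \<le> G (p n) - G x"
    by auto
  moreover have "max (g y - g (p n)) 0 \<le> G y - G (p n)"
    using assms(3)[of "p n" y] IH(1) * Suc.prems(2) by simp
  ultimately show ?case using * by (simp del: max.bounded_iff)
qed

lemma increment_le_pos_variation:
  assumes "x \<le> y"
  shows "ereal (max (g y - g x) 0) \<le> pos_variation g x y"
proof (cases "x = y")
  case False
  define p where "p i = (if i = 0 then x else y)" for i :: nat
  have "is_partition x y 1 p"
    using False assms by (simp add: is_partition_def p_def)
  then have "ereal (\<Sum>i=1..1. max (g (p i) - g (p (i - 1))) 0) \<le> pos_variation g x y"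
    unfolding pos_variation_def if_not_P[OF False] by (intro Sup_upper) blast
  then show ?thesis by (simp add: p_def)
qed (simp add: pos_variation_def)

text \<open>This removes the suprema from (b). The quantification over all subintervals is
  essential: the bound for one partition uses the increment bound on each of its intervals.\<close>

lemma pos_variation_le_increment_iff:
  fixes g G :: "real \<Rightarrow> real"
  shows "(\<forall>x y. a \<le> x \<and> x \<le> y \<and> y \<le> b \<longrightarrow> pos_variation g x y \<le> ereal (G y - G x)) \<longleftrightarrow>
    (\<forall>x y. a \<le> x \<and> x \<le> y \<and> y \<le> b \<longrightarrow> max (g y - g x) 0 \<le> G y - G x)"
    (is "?var \<longleftrightarrow> ?inc")
proof
  assume ?var
  show ?inc
  proof (intro allI impI)
    fix x y assume xy: "a \<le> x \<and> x \<le> y \<and> y \<le> b"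
    with increment_le_pos_variation[of x y g]
    have "ereal (max (g y - g x) 0) \<le> pos_variation g x y" by blast
    also have "\<dots> \<le> ereal (G y - G x)" using \<open>?var\<close> xy by blast
    finally show "max (g y - g x) 0 \<le> G y - G x" by (simp only: ereal_less_eq)
  qed
next
  assume inc: ?inc
  show ?var
  proof (intro allI impI)
    fix x y assume "a \<le> x \<and> x \<le> y \<and> y \<le> b"
    then have "(\<Sum>i=1..n. max (g (p i) - g (p (i - 1))) 0) \<le> G y - G x"
      if "is_partition x y n p" for n p
      using partition_sum_le[OF that, of b g G] inc by auto
    then show "pos_variation g x y \<le> ereal (G y - G x)"
      by (auto simp: pos_variation_def intro!: Sup_least)
  qed
qed

text \<open>For \<open>V\<close> equal to plus infinity both sides fail, and for minus infinity both
  hold, so unbounded variation is covered.\<close>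

lemma ereal_le_diff_swap: "ereal a \<le> ereal b - V \<longleftrightarrow> V \<le> ereal (b - a)"
  by (cases V) auto

text \<open>The rectangles over \<open>[x1, x2]\<close> with vertical sides \<open>[0, y]\<close>
  and \<open>[y, 1]\<close> have nonnegative volume, and the marginal conditions evaluate their
  outer corners.\<close>

lemma copula_increment_fst:
  assumes "copula C" "0 \<le> x1" "x1 \<le> x2" "x2 \<le> 1" "y \<in> {0..1}"
  shows "C x1 y \<le> C x2 y" "C x2 y - C x1 y \<le> x2 - x1"
proof -
  have marg: "C x 0 = 0" "C x 1 = x" if "x \<in> {0..1}" for x
    using assms(1) that by (auto simp: copula_def)
  have rect: "C x2 v - C x1 v - C x2 u + C x1 u \<ge> 0"
    if "u \<in> {0..1}" "v \<in> {0..1}" "u \<le> v" for u v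
    using assms(1-4) that unfolding copula_def by auto
  show "C x1 y \<le> C x2 y"
    using rect[of 0 y] marg[of x1] marg[of x2] assms by simp
  show "C x2 y - C x1 y \<le> x2 - x1"
    using rect[of y 1] marg[of x1] marg[of x2] assms by simp
qed

lemma copula_swap:
  assumes "copula C"
  shows "copula (\<lambda>x y. C y x)"
  unfolding copula_def
proof (intro conjI ballI impI)
  fix x1 x2 y1 y2 :: real
  assume "x1 \<in> {0..1}" "x2 \<in> {0..1}" "y1 \<in> {0..1}" "y2 \<in> {0..1}" "x1 \<le> x2" "y1 \<le> y2"
  then have "C y2 x2 - C y1 x2 - C y2 x1 + C y1 x1 \<ge> 0"
    using assms unfolding copula_def by blast
  then show "C y2 x2 - C y2 x1 - C y1 x2 + C y1 x1 \<ge> 0" by simp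
qed (use assms in \<open>auto simp: copula_def\<close>)

text \<open>For fixed \<open>f\<close>, the difference \<open>min f g2 - min f g1\<close> is the
  length of the part of \<open>[g1, g2]\<close> below \<open>f\<close>, which grows with
  \<open>f\<close>.\<close>

lemma min_two_increasing:
  fixes f1 f2 g1 g2 :: real
  assumes "f1 \<le> f2" "g1 \<le> g2"
  shows "min f2 g2 - min f1 g2 - min f2 g1 + min f1 g1 \<ge> 0"
  using assms by (auto simp: min_def)

lemma two_increasing_imp_copula:
  assumes marg: "\<And>x. x \<in> {0..1} \<Longrightarrow> C x 0 = 0 \<and> C 0 x = 0 \<and> C x 1 = x \<and> C 1 x = x"
    and rect: "\<And>x1 x2 y1 y2. 0 \<le> x1 \<Longrightarrow> x1 \<le> x2 \<Longrightarrow> x2 \<le> 1 \<Longrightarrow> 0 \<le> y1 \<Longrightarrow> y1 \<le> y2 \<Longrightarrow> y2 \<le> 1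
      \<Longrightarrow> C x2 y2 - C x1 y2 - C x2 y1 + C x1 y1 \<ge> 0"
  shows "copula C"
proof -
  have "C x y \<in> {0..1}" if "x \<in> {0..1}" "y \<in> {0..1}" for x y
    \<comment> \<open>The first rectangle gives \<open>C x y \<ge> 0\<close>, the second
      \<open>C x y \<le> y\<close>.\<close>
    using rect[of 0 x 0 y] rect[of x 1 0 y] marg[of x] marg[of y] marg[of 0] marg[of 1] that
    by auto
  then show ?thesis
    using marg rect by (auto simp: copula_def)
qed

lemma track_function_le_iff:
  assumes "track_function \<phi>" "s \<in> {0..1}" "t \<in> {0..1}"
  shows "\<phi> s \<le> \<phi> t \<longleftrightarrow> s \<le> t"
  using assms strict_mono_on_less_eq[of "{0..1}" \<phi> s t] by (simp add: track_function_def)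

lemma track_function_inv:
  assumes "track_function \<phi>" "t \<in> {0..1}"
  shows "inv_into {0..1} \<phi> (\<phi> t) = t"
  using assms strict_mono_on_imp_inj_on[of "{0..1}" \<phi>] by (simp add: track_function_def)

lemma track_function_image:
  assumes "track_function \<phi>"
  shows "\<phi> ` {0..1} = {0..1}"
proof (intro subset_antisym subsetI)
  fix y :: real assume "y \<in> {0..1}"
  then show "y \<in> \<phi> ` {0..1}"
    using assms IVT'[of \<phi> 0 y 1] by (force simp: track_function_def)
qed (use assms in \<open>auto simp: track_function_def\<close>)

text \<open>Substituting \<open>y = \<phi> t\<close> eliminates the inverse of \<open>\<phi>\<close>
  and expresses all four canonical functions in the same parameter.\<close>

lemma mono_on_track_iff:
  assumes "track_function \<phi>"
  shows "mono_on {0..1} h \<longleftrightarrow>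
    (\<forall>s t. 0 \<le> s \<and> s \<le> t \<and> t \<le> 1 \<longrightarrow> h (\<phi> s) \<le> h (\<phi> t))" (is "_ \<longleftrightarrow> ?comp")
proof -
  have "mono_on (\<phi> ` {0..1}) h \<longleftrightarrow> ?comp"
    using track_function_le_iff[OF assms] by (force simp: mono_on_def)
  then show ?thesis by (simp add: track_function_image[OF assms])
qed

lemma can_eta_track:
  assumes "track_function \<phi>" "t \<in> {0..1}"
  shows "can_eta \<phi> \<delta> \<psi> (\<phi> t) = \<delta> t - \<psi> t"
  using assms by (simp add: can_eta_def track_function_inv)

lemma can_C_le: "can_C \<phi> \<delta> \<psi> x y \<le> \<psi> x + can_eta \<phi> \<delta> \<psi> y"
  by (simp add: can_C_def add_mono)

text \<open>At \<open>(t, \<phi> t)\<close> the first minimum is \<open>\<psi> t\<close> because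
  \<open>\<delta> t \<le> \<phi> t\<close>, and the second is \<open>\<delta> t - \<psi> t\<close>
  because \<open>\<delta> t \<le> t\<close>.\<close>

lemma can_C_track:
  assumes "track_function \<phi>" "t \<in> {0..1}" "\<delta> t \<le> min t (\<phi> t)"
  shows "can_C \<phi> \<delta> \<psi> t (\<phi> t) = \<delta> t"
  using assms by (simp add: can_C_def can_chi_def can_xi_def can_eta_track)

lemma canonical_mono_iff:
  assumes "track_function \<phi>"
  shows "mono_on {0..1} \<psi> \<and> mono_on {0..1} (can_chi \<phi> \<delta> \<psi>) \<and>
      mono_on {0..1} (can_eta \<phi> \<delta> \<psi>) \<and> mono_on {0..1} (can_xi \<psi>) \<longleftrightarrow>
    (\<forall>s t. 0 \<le> s \<and> s \<le> t \<and> t \<le> 1 \<longrightarrow>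
      0 \<le> \<psi> t - \<psi> s \<and> \<delta> t - \<delta> s - (\<phi> t - \<phi> s) \<le> \<psi> t - \<psi> s \<and>
      \<psi> t - \<psi> s \<le> \<delta> t - \<delta> s \<and> \<psi> t - \<psi> s \<le> t - s)" (is "?mono \<longleftrightarrow> ?inc")
proof -
  have *: "mono_on {0..1} h \<longleftrightarrow> (\<forall>s t. 0 \<le> s \<and> s \<le> t \<and> t \<le> 1 \<longrightarrow> h s \<le> h t)"
    for h :: "real \<Rightarrow> real"
    by (force simp: mono_on_def)
  have "?mono \<longleftrightarrow> (\<forall>s t. 0 \<le> s \<and> s \<le> t \<and> t \<le> 1 \<longrightarrow> \<psi> s \<le> \<psi> t \<and>
      can_chi \<phi> \<delta> \<psi> (\<phi> s) \<le> can_chi \<phi> \<delta> \<psi> (\<phi> t) \<and>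
      can_eta \<phi> \<delta> \<psi> (\<phi> s) \<le> can_eta \<phi> \<delta> \<psi> (\<phi> t) \<and> can_xi \<psi> s \<le> can_xi \<psi> t)"
    unfolding mono_on_track_iff[OF assms, of "can_chi \<phi> \<delta> \<psi>"]
      mono_on_track_iff[OF assms, of "can_eta \<phi> \<delta> \<psi>"] *[of \<psi>] *[of "can_xi \<psi>"] by blast
  also have "\<dots> \<longleftrightarrow> ?inc"
    by (intro all_cong1 imp_cong refl)
      (auto simp: can_chi_def can_xi_def can_eta_track[OF assms])
  finally show ?thesis .
qed

lemma canonical_mono_imp_copula:
  assumes \<phi>: "track_function \<phi>" and "\<delta> 0 = 0" "\<delta> 1 = 1" "\<psi> 0 = 0"
    and mono: "mono_on {0..1} \<psi>" "mono_on {0..1} (can_chi \<phi> \<delta> \<psi>)"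
      "mono_on {0..1} (can_eta \<phi> \<delta> \<psi>)" "mono_on {0..1} (can_xi \<psi>)"
  shows "copula (can_C \<phi> \<delta> \<psi>)"
proof (rule two_increasing_imp_copula)
  fix x :: real assume x: "x \<in> {0..1}"
  \<comment> \<open>All four functions vanish at 0, and at 1 \<open>can_chi\<close> agrees with
    \<open>\<psi>\<close> and \<open>can_eta\<close> with \<open>can_xi\<close>. By monotonicity
    both minima are then 0 on the lower edges, while on the upper edges they are the values at
    \<open>x\<close> of two functions with sum \<open>x\<close>.\<close>
  have "can_eta \<phi> \<delta> \<psi> 0 = 0" "can_eta \<phi> \<delta> \<psi> 1 = 1 - \<psi> 1"
    using can_eta_track[OF \<phi>, of 0] can_eta_track[OF \<phi>, of 1] assms
    by (auto simp: track_function_def)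
  moreover from this have "can_chi \<phi> \<delta> \<psi> 0 = 0" "can_chi \<phi> \<delta> \<psi> 1 = \<psi> 1"
    by (simp_all add: can_chi_def)
  moreover have "can_xi \<psi> 0 = 0" "can_xi \<psi> 1 = 1 - \<psi> 1"
    using assms by (simp_all add: can_xi_def)
  moreover have "f 0 \<le> f x" "f x \<le> f 1" if "mono_on {0..1} f" for f :: "real \<Rightarrow> real"
    using mono_onD[OF that, of 0 x] mono_onD[OF that, of x 1] x by auto
  note this[OF mono(1)] this[OF mono(2)] this[OF mono(3)] this[OF mono(4)]
  ultimately show "can_C \<phi> \<delta> \<psi> x 0 = 0 \<and> can_C \<phi> \<delta> \<psi> 0 x = 0 \<and>
      can_C \<phi> \<delta> \<psi> x 1 = x \<and> can_C \<phi> \<delta> \<psi> 1 x = x"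
    using \<open>\<psi> 0 = 0\<close> by (simp add: can_C_def min_def can_xi_def can_chi_def)
next
  fix x1 x2 y1 y2 :: real
  assume *: "0 \<le> x1" "x1 \<le> x2" "x2 \<le> 1" "0 \<le> y1" "y1 \<le> y2" "y2 \<le> 1"
  have x: "f x1 \<le> f x2" and y: "f y1 \<le> f y2"
    if "mono_on {0..1} f" for f :: "real \<Rightarrow> real"
    using mono_onD[OF that, of x1 x2] mono_onD[OF that, of y1 y2] * by auto
  show "can_C \<phi> \<delta> \<psi> x2 y2 - can_C \<phi> \<delta> \<psi> x1 y2 - can_C \<phi> \<delta> \<psi> x2 y1 + can_C \<phi> \<delta> \<psi> x1 y1 \<ge> 0"
    using min_two_increasing[OF x[OF mono(1)] y[OF mono(2)]]
      min_two_increasing[OF x[OF mono(4)] y[OF mono(3)]]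
    by (simp add: can_C_def)
qed

lemma copula_imp_increments:
  assumes \<phi>: "track_function \<phi>"
    and diag: "\<And>t. t \<in> {0..1} \<Longrightarrow> can_C \<phi> \<delta> \<psi> t (\<phi> t) = \<delta> t"
    and C: "copula (can_C \<phi> \<delta> \<psi>)"
    and st: "0 \<le> s" "s \<le> t" "t \<le> 1"
  shows "0 \<le> \<psi> t - \<psi> s \<and> \<delta> t - \<delta> s - (\<phi> t - \<phi> s) \<le> \<psi> t - \<psi> s \<and>
      \<psi> t - \<psi> s \<le> \<delta> t - \<delta> s \<and> \<psi> t - \<psi> s \<le> t - s"
proof -
  have s: "s \<in> {0..1}" and t: "t \<in> {0..1}" using st by auto
  have \<phi>01: "\<phi> s \<in> {0..1}" "\<phi> t \<in> {0..1}"
    using track_function_image[OF \<phi>] s t by blast+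
  have \<phi>st: "0 \<le> \<phi> s" "\<phi> s \<le> \<phi> t" "\<phi> t \<le> 1"
    using \<phi>01 track_function_le_iff[OF \<phi> s t] st by auto
  have off: "can_C \<phi> \<delta> \<psi> t (\<phi> s) \<le> \<psi> t + (\<delta> s - \<psi> s)" "can_C \<phi> \<delta> \<psi> s (\<phi> t) \<le> \<psi> s + (\<delta> t - \<psi> t)"
    using can_C_le[of \<phi> \<delta> \<psi> t "\<phi> s"] can_C_le[of \<phi> \<delta> \<psi> s "\<phi> t"] s t
    by (simp_all add: can_eta_track[OF \<phi>])
  note fst_s = copula_increment_fst[OF C st \<phi>01(1)]
  note fst_t = copula_increment_fst[OF C st \<phi>01(2)]
  note snd_s = copula_increment_fst[OF copula_swap[OF C] \<phi>st s]
  note snd_t = copula_increment_fst[OF copula_swap[OF C] \<phi>st t]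
  \<comment> \<open>The four copula facts, in the order listed, bound the increment of
    \<open>\<psi>\<close> below by 0, above by that of the identity, above by that of
    \<open>\<delta>\<close>, and below by that of \<open>\<delta> - \<phi>\<close>. In each, the
    graph corner has value \<open>\<delta> s\<close> or \<open>\<delta> t\<close> and the other
    corner is bounded by \<open>off\<close>.\<close>
  show ?thesis
    using off fst_s(1) fst_t(2) snd_s(1) snd_t(2) diag[OF s] diag[OF t] by linarith
qed

theorem theorem5p1:
  fixes \<phi> \<delta> \<psi> :: "real \<Rightarrow> real"
  assumes "track_function \<phi>"
    and "\<delta> \<in> {0..1} \<rightarrow> {0..1}"
    and "mono_on {0..1} \<delta>"
    and "\<delta> 1 = 1"
    and "\<And>t. t \<in> {0..1} \<Longrightarrow> \<delta> t \<le> min t (\<phi> t)"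
    and "\<psi> 0 = 0"
  defines "cond_a \<equiv> mono_on {0..1} \<psi> \<and> mono_on {0..1} (can_chi \<phi> \<delta> \<psi>) \<and>
             mono_on {0..1} (can_eta \<phi> \<delta> \<psi>) \<and> mono_on {0..1} (can_xi \<psi>)"
    and "cond_b \<equiv> (\<forall>x y. 0 \<le> x \<and> x \<le> y \<and> y \<le> 1 \<longrightarrow>
             neg_variation (\<lambda>t. \<phi> t - \<delta> t) x y \<le> ereal (\<psi> y - \<psi> x) \<and>
             ereal (\<psi> y - \<psi> x) \<le> ereal (y - x) - pos_variation (\<lambda>t. t - \<delta> t) x y)"
    and "cond_c \<equiv> copula (can_C \<phi> \<delta> \<psi>) \<and> (\<forall>x\<in>{0..1}. can_C \<phi> \<delta> \<psi> x (\<phi> x) = \<delta> x)"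
  shows "(cond_a \<longleftrightarrow> cond_b) \<and> (cond_b \<longleftrightarrow> cond_c)"
proof -
  have \<phi>: "track_function \<phi>" by fact
  have \<delta>0: "\<delta> 0 = 0"
    using assms(2) assms(5)[of 0] by (force simp: Pi_iff)
  have a_iff: "cond_a \<longleftrightarrow> (\<forall>s t. 0 \<le> s \<and> s \<le> t \<and> t \<le> 1 \<longrightarrow>
      0 \<le> \<psi> t - \<psi> s \<and> \<delta> t - \<delta> s - (\<phi> t - \<phi> s) \<le> \<psi> t - \<psi> s \<and>
      \<psi> t - \<psi> s \<le> \<delta> t - \<delta> s \<and> \<psi> t - \<psi> s \<le> t - s)"
    unfolding cond_a_def by (rule canonical_mono_iff[OF \<phi>])
  \<comment> \<open>Both halves of (b) become upper bounds on a positive variation, by increments of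
    \<open>\<psi>\<close> and of the identity minus \<open>\<psi>\<close> respectively.\<close>
  have "cond_b \<longleftrightarrow>
      (\<forall>x y. 0 \<le> x \<and> x \<le> y \<and> y \<le> 1 \<longrightarrow>
        pos_variation (\<lambda>t. - (\<phi> t - \<delta> t)) x y \<le> ereal (\<psi> y - \<psi> x)) \<and>
      (\<forall>x y. 0 \<le> x \<and> x \<le> y \<and> y \<le> 1 \<longrightarrow>
        pos_variation (\<lambda>t. t - \<delta> t) x y \<le> ereal ((y - \<psi> y) - (x - \<psi> x)))"
    unfolding cond_b_def neg_variation_eq_pos_variation ereal_le_diff_swap
    by (auto simp: algebra_simps)
  also have "\<dots> \<longleftrightarrow> cond_a"
    \<comment> \<open>Each maximum splits into two inequalities. The first pair says that
      \<open>can_chi\<close> and \<open>\<psi>\<close> increase, the second that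
      \<open>can_eta\<close> and \<open>can_xi\<close> do.\<close>
    unfolding pos_variation_le_increment_iff a_iff max_def by (smt (verit))
  finally have "cond_a \<longleftrightarrow> cond_b" by simp
  moreover have "cond_a \<longleftrightarrow> cond_c"
  proof
    assume cond_a
    then show cond_c
      using canonical_mono_imp_copula[of \<phi> \<delta> \<psi>] can_C_track[OF \<phi>] \<phi> \<delta>0 assms(4-6)
      unfolding cond_a_def cond_c_def by blast
  next
    assume cond_c
    then show cond_a
      unfolding a_iff cond_c_def using copula_imp_increments[OF \<phi>] by blast
  qed
  ultimately show ?thesis by blast
qed

end
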